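(* Let $G=(V,E)$ be a regular graph, $t\ge1$ an integer, and let $L(G)$ be its line graph with adjacency matrix $A'$ and eigenvalues $\lambda'_1\ge\lambda'_2\ge\cdots\ge\lambda'_m$, $m=|E|\ge 2$. Let $p\in\mathbb{R}_t[x]$, set $W'(p):=\max_{e\in E}(p(A'))_{ee}$ and $\lambda'(p):=\min_{2\le i\le m}p(\lambda'_i)$, and assume $p(\lambda'_1)>\lambda'(p)$. Then $$\chi'_t(G)\ \ge\ \frac{|E|}{\left\lfloor |E|\,\frac{W'(p)-\lambda'(p)}{p(\lambda'_1)-\lambda'(p)}\right\rfloor}.$$
   Context: All graphs are finite, simple and undirected. The line graph $L(G)$ has vertex set $E$, two edges adjacent iff they share an endpoint. $\chi'_t(G)$ is the least number of colours in a colouring of the edges of $G$ in which any two distinct edges at distance at most $t$ in $L(G)$ get distinct colours (i.e. the chromatic number of $L(G)^t$). $\mathbb{R}_t[x]$ denotes the real polynomials of degree at most $t$. *)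

theory Defs
  imports "Jordan_Normal_Form.Char_Poly" "HOL-Library.Extended_Nat"
begin

text \<open>A graph is a vertex set together with a set of edges, each edge being a two-element
  set of vertices.\<close>

definition finite_simple_graph :: "'v set \<Rightarrow> 'v set set \<Rightarrow> bool" where
  "finite_simple_graph V E \<longleftrightarrow> finite V \<and> (\<forall>e\<in>E. e \<subseteq> V \<and> card e = 2)"

definition vertex_degree :: "'v set set \<Rightarrow> 'v \<Rightarrow> nat" where
  "vertex_degree E v = card {e \<in> E. v \<in> e}"

definition regular_graph :: "'v set \<Rightarrow> 'v set set \<Rightarrow> bool" where
  "regular_graph V E \<longleftrightarrow> (\<exists>k. \<forall>v\<in>V. vertex_degree E v = k)"

text \<open>The edges of the line graph, whose vertex set is \<open>E\<close>.\<close>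

definition line_graph_edges :: "'v set set \<Rightarrow> 'v set set set" where
  "line_graph_edges E = {{e, f} |e f. e \<in> E \<and> f \<in> E \<and> e \<noteq> f \<and> e \<inter> f \<noteq> {}}"

text \<open>The walks of length \<open>n\<close> are the \<open>n\<close>-th relational power of adjacency; the distance is
  \<open>\<infinity>\<close> between different components.\<close>

definition graph_dist :: "'v set set \<Rightarrow> 'v \<Rightarrow> 'v \<Rightarrow> enat" where
  "graph_dist E u v = Inf {enat n |n. (u, v) \<in> {(x, y). {x, y} \<in> E} ^^ n}"

definition distance_edge_colouring :: "nat \<Rightarrow> 'v set set \<Rightarrow> ('v set \<Rightarrow> nat) \<Rightarrow> bool" where
  "distance_edge_colouring t E c \<longleftrightarrow>
     (\<forall>e\<in>E. \<forall>f\<in>E. e \<noteq> f \<and> graph_dist (line_graph_edges E) e f \<le> enat t \<longrightarrow> c e \<noteq> c f)"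

definition distance_chromatic_index :: "nat \<Rightarrow> 'v set set \<Rightarrow> nat" where
  "distance_chromatic_index t E =
     (LEAST k. \<exists>c. distance_edge_colouring t E c \<and> card (c ` E) = k)"

text \<open>The adjacency matrix with respect to an enumeration \<open>vs\<close> of the vertices.\<close>

definition adjacency_matrix :: "'v list \<Rightarrow> 'v set set \<Rightarrow> real mat" where
  "adjacency_matrix vs E =
     mat (length vs) (length vs) (\<lambda>(i, j). if {vs ! i, vs ! j} \<in> E then 1 else 0)"

text \<open>The \<open>i\<close>-th largest eigenvalue, counted with algebraic multiplicity and starting from
  \<open>i = 1\<close>; meaningful if the characteristic polynomial splits over the reals, as it does for
  symmetric matrices.\<close>

definition eigval :: "real mat \<Rightarrow> nat \<Rightarrow> real" where
  "eigval A i = rev (sorted_list_of_multiset (proots (char_poly A))) ! (i - 1)"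

definition poly_mat :: "real poly \<Rightarrow> real mat \<Rightarrow> real mat" where
  "poly_mat p A = mat (dim_row A) (dim_row A)
     (\<lambda>(i, j). \<Sum>k\<le>degree p. coeff p k * (A ^\<^sub>m k) $$ (i, j))"

definition max_diag :: "real poly \<Rightarrow> real mat \<Rightarrow> real" where
  "max_diag p A = Max {poly_mat p A $$ (i, i) |i. i < dim_row A}"

definition min_nonprincipal :: "real poly \<Rightarrow> real mat \<Rightarrow> real" where
  "min_nonprincipal p A = Min {poly p (eigval A i) |i. 2 \<le> i \<and> i \<le> dim_row A}"

end

theory Submission
  imports Defs "HOL-Computational_Algebra.Fundamental_Theorem_Algebra"
begin

text \<open>
  The line graph of a regular graph is regular, so the all-ones vector is an eigenvector
  of \<open>A'\<close> for \<open>\<lambda>'\<^sub>1\<close>. Put \<open>q = p - \<lambda>'(p)\<close>; then \<open>q\<close> is nonnegative at every eigenvalue and \<open>q(A')\<close> is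
  positive semidefinite. For a colour class \<open>U\<close> of size \<open>s\<close>, entries of \<open>p(A')\<close> between different
  elements of \<open>U\<close> vanish, being combinations of numbers of walks of length at most \<open>t\<close>; thus the quadratic form of
  \<open>q(A')\<close> at the indicator vector of \<open>U\<close> is at most \<open>s (W'(p) - \<lambda>'(p))\<close>. Splitting off the component
  along the all-ones vector bounds it from below by \<open>q(\<lambda>'\<^sub>1) s\<^sup>2 / m\<close>. Hence every colour class has at
  most \<open>m (W'(p) - \<lambda>'(p)) / (p(\<lambda>'\<^sub>1) - \<lambda>'(p))\<close> elements.

  Semidefiniteness is obtained without a spectral decomposition: each vector \<open>v\<close> is annihilated by
  some \<open>M(A')\<close> with \<open>M\<close> a product of distinct linear factors at eigenvalues. If \<open>r\<close> interpolates
  \<open>sqrt q\<close> at these, then \<open>M\<close> divides \<open>q - r\<^sup>2\<close>, so \<open>v \<bullet> q(A') v = |r(A') v|\<^sup>2\<close>.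
\<close>

section \<open>Polynomials in a square matrix\<close>

lemma poly_mat_carrier [simp]:
  "A \<in> carrier_mat n n \<Longrightarrow> poly_mat p A \<in> carrier_mat n n"
  by (auto simp: poly_mat_def)

lemma dim_poly_mat [simp]:
  "dim_row (poly_mat p A) = dim_row A" "dim_col (poly_mat p A) = dim_row A"
  by (auto simp: poly_mat_def)

text \<open>Letting the sum run to any \<open>N\<close> beyond the degree lets polynomials of
  different degrees be compared coefficient by coefficient.\<close>

lemma poly_mat_index:
  assumes "A \<in> carrier_mat n n" "i < n" "j < n" "degree p \<le> N"
  shows "poly_mat p A $$ (i, j) = (\<Sum>k\<le>N. coeff p k * (A ^\<^sub>m k) $$ (i, j))"
proof -
  have "poly_mat p A $$ (i, j) = (\<Sum>k\<le>degree p. coeff p k * (A ^\<^sub>m k) $$ (i, j))"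
    using assms by (auto simp: poly_mat_def)
  also have "\<dots> = (\<Sum>k\<le>N. coeff p k * (A ^\<^sub>m k) $$ (i, j))"
    using assms(4) by (intro sum.mono_neutral_left) (auto simp: coeff_eq_0)
  finally show ?thesis .
qed

lemma poly_mat_0 [simp]: "A \<in> carrier_mat n n \<Longrightarrow> poly_mat 0 A = 0\<^sub>m n n"
  by (intro eq_matI) (auto simp: poly_mat_index)

lemma poly_mat_add:
  assumes "A \<in> carrier_mat n n"
  shows "poly_mat (p + q) A = poly_mat p A + poly_mat q A"
proof (intro eq_matI)
  fix i j assume "i < dim_row (poly_mat p A + poly_mat q A)"
    "j < dim_col (poly_mat p A + poly_mat q A)"
  then have ij: "i < n" "j < n" using assms by auto
  let ?N = "max (degree p) (degree q)"
  show "poly_mat (p + q) A $$ (i, j) = (poly_mat p A + poly_mat q A) $$ (i, j)"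
    using assms ij poly_mat_index[OF assms ij, of "p + q" ?N] poly_mat_index[OF assms ij, of p ?N]
      poly_mat_index[OF assms ij, of q ?N]
    by (simp add: degree_add_le_max sum.distrib algebra_simps)
qed (use assms in auto)

lemma poly_mat_smult:
  assumes "A \<in> carrier_mat n n"
  shows "poly_mat (Polynomial.smult a p) A = a \<cdot>\<^sub>m poly_mat p A"
proof (intro eq_matI)
  fix i j assume "i < dim_row (a \<cdot>\<^sub>m poly_mat p A)" "j < dim_col (a \<cdot>\<^sub>m poly_mat p A)"
  then have ij: "i < n" "j < n" using assms by auto
  show "poly_mat (Polynomial.smult a p) A $$ (i, j) = (a \<cdot>\<^sub>m poly_mat p A) $$ (i, j)"
    using assms ij poly_mat_index[OF assms ij, of "Polynomial.smult a p" "degree p"]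
      poly_mat_index[OF assms ij, of p "degree p"]
    by (simp add: degree_smult_le sum_distrib_left algebra_simps)
qed (use assms in auto)

text \<open>The Horner step. It makes induction over \<open>pCons\<close> available for products and
  eigenvectors.\<close>

lemma poly_mat_pCons:
  assumes A: "A \<in> carrier_mat n n"
  shows "poly_mat (pCons a p) A = a \<cdot>\<^sub>m 1\<^sub>m n + poly_mat p A * A"
proof (intro eq_matI)
  fix i j assume "i < dim_row (a \<cdot>\<^sub>m 1\<^sub>m n + poly_mat p A * A)"
    "j < dim_col (a \<cdot>\<^sub>m 1\<^sub>m n + poly_mat p A * A)"
  then have ij: "i < n" "j < n" using A by auto
  have "poly_mat (pCons a p) A $$ (i, j) =
      (\<Sum>k\<le>Suc (degree p). coeff (pCons a p) k * (A ^\<^sub>m k) $$ (i, j))"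
    by (intro poly_mat_index[OF A ij]) (rule degree_pCons_le)
  also have "\<dots> = a * (1\<^sub>m n) $$ (i, j) + (\<Sum>k\<le>degree p. coeff p k * (A ^\<^sub>m Suc k) $$ (i, j))"
    using A by (subst sum.atMost_Suc_shift) (auto simp del: pow_mat.simps(2))
  also have "(\<Sum>k\<le>degree p. coeff p k * (A ^\<^sub>m Suc k) $$ (i, j)) =
      (\<Sum>k\<le>degree p. \<Sum>l<n. coeff p k * (A ^\<^sub>m k) $$ (i, l) * A $$ (l, j))"
    using A ij by (intro sum.cong) (auto simp: scalar_prod_def sum_distrib_left algebra_simps
      lessThan_atLeast0)
  also have "\<dots> = (\<Sum>l<n. poly_mat p A $$ (i, l) * A $$ (l, j))"
    using ij by (subst sum.swap) (auto simp: poly_mat_index[OF A _ _ order.refl] sum_distrib_right)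
  also have "\<dots> = (poly_mat p A * A) $$ (i, j)"
    using A ij by (auto simp: scalar_prod_def lessThan_atLeast0)
  finally show "poly_mat (pCons a p) A $$ (i, j) = (a \<cdot>\<^sub>m 1\<^sub>m n + poly_mat p A * A) $$ (i, j)"
    using A ij by simp
qed (use A in auto)

lemma poly_mat_mult:
  assumes A: "A \<in> carrier_mat n n"
  shows "poly_mat (p * q) A = poly_mat p A * poly_mat q A"
proof (induction q)
  case 0
  then show ?case using A by (simp add: right_mult_zero_mat[of _ n n])
next
  case (pCons a q)
  let ?P = "poly_mat p A" and ?Q = "poly_mat q A"
  have P: "?P \<in> carrier_mat n n" and Q: "?Q \<in> carrier_mat n n" using A by auto
  have "poly_mat (p * pCons a q) A = a \<cdot>\<^sub>m ?P + (0 \<cdot>\<^sub>m 1\<^sub>m n + ?P * ?Q * A)"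
    by (simp add: mult_pCons_right poly_mat_add[OF A] poly_mat_smult[OF A] poly_mat_pCons[OF A]
        pCons.IH)
  also have "0 \<cdot>\<^sub>m 1\<^sub>m n + ?P * ?Q * A = ?P * ?Q * A"
    using A P Q by (intro eq_matI) auto
  also have "a \<cdot>\<^sub>m ?P + ?P * ?Q * A = ?P * (a \<cdot>\<^sub>m 1\<^sub>m n + ?Q * A)"
    using A P Q by (subst mult_add_distrib_mat[of _ n n _ n])
      (auto simp: mult_smult_distrib[of _ n n _ n] assoc_mult_mat[of _ n n _ n _ n])
  finally show ?case by (simp add: poly_mat_pCons[OF A])
qed

text \<open>Since real polynomials commute, this also allows the factors to be applied to a vector
  in either order.\<close>

lemma poly_mat_mult_vec:
  assumes "A \<in> carrier_mat n n" "v \<in> carrier_vec n"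
  shows "poly_mat (p * q) A *\<^sub>v v = poly_mat p A *\<^sub>v (poly_mat q A *\<^sub>v v)"
  using assms by (simp add: poly_mat_mult[OF assms(1)] assoc_mult_mat_vec[of _ n n _ n])

lemma smult_mat_mult_vec:
  assumes "(A :: 'a :: comm_semiring_0 mat) \<in> carrier_mat n m" "v \<in> carrier_vec m"
  shows "(a \<cdot>\<^sub>m A) *\<^sub>v v = a \<cdot>\<^sub>v (A *\<^sub>v v)"
  using assms by (intro eq_vecI) (auto simp: scalar_prod_def sum_distrib_left algebra_simps)

lemma poly_mat_linear_vec:
  assumes A: "A \<in> carrier_mat n n" and v: "v \<in> carrier_vec n"
  shows "poly_mat [:a, b:] A *\<^sub>v v = a \<cdot>\<^sub>v v + b \<cdot>\<^sub>v (A *\<^sub>v v)"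
proof -
  have "poly_mat [:a, b:] A = a \<cdot>\<^sub>m 1\<^sub>m n + b \<cdot>\<^sub>m A"
    using A by (intro eq_matI) (auto simp: poly_mat_pCons[OF A])
  then show ?thesis
    using A v by (auto simp: add_mult_distrib_mat_vec[of _ n n] smult_mat_mult_vec[of _ n n])
qed

lemma poly_mat_const_vec:
  assumes "A \<in> carrier_mat n n" "v \<in> carrier_vec n"
  shows "poly_mat [:a:] A *\<^sub>v v = a \<cdot>\<^sub>v v"
  using poly_mat_linear_vec[OF assms, of a 0] assms by (auto simp: mult_mat_vec_carrier[of _ n n])

lemma poly_mat_add_vec:
  assumes "A \<in> carrier_mat n n" "v \<in> carrier_vec n"
  shows "poly_mat (p + q) A *\<^sub>v v = poly_mat p A *\<^sub>v v + poly_mat q A *\<^sub>v v"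
  using assms by (simp add: poly_mat_add[OF assms(1)] add_mult_distrib_mat_vec[of _ n n])

lemma poly_mat_eigenvector:
  assumes A: "A \<in> carrier_mat n n" and v: "v \<in> carrier_vec n" and ev: "A *\<^sub>v v = c \<cdot>\<^sub>v v"
  shows "poly_mat p A *\<^sub>v v = poly p c \<cdot>\<^sub>v v"
proof (induction p)
  case 0
  then show ?case using A v by (intro eq_vecI) auto
next
  case (pCons a p)
  have "poly_mat (pCons a p) A *\<^sub>v v = a \<cdot>\<^sub>v v + poly_mat p A *\<^sub>v (A *\<^sub>v v)"
    using A v by (simp add: poly_mat_pCons[OF A] add_mult_distrib_mat_vec[of _ n n]
        mult_carrier_mat[of _ n n] smult_mat_mult_vec[of _ n n] assoc_mult_mat_vec[of _ n n _ n])
  also have "poly_mat p A *\<^sub>v (A *\<^sub>v v) = c \<cdot>\<^sub>v (poly p c \<cdot>\<^sub>v v)"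
    using A v by (simp add: ev mult_mat_vec[of _ n n] pCons.IH)
  finally show ?case using v by (auto simp: algebra_simps)
qed

section \<open>Self-adjointness of polynomials in a symmetric matrix\<close>

lemma pow_mat_commute:
  assumes A: "A \<in> carrier_mat n n"
  shows "A * A ^\<^sub>m k = A ^\<^sub>m k * A"
proof (induction k)
  case (Suc k)
  then show ?case using A by (simp flip: assoc_mult_mat[of _ n n _ n _ n])
qed (use A in simp)

text \<open>Transposition reverses the product, and \<open>pow_mat_commute\<close> restores the
  order of the factors.\<close>

lemma transpose_pow_mat:
  assumes A: "(A :: 'a :: comm_semiring_1 mat) \<in> carrier_mat n n"
  shows "(A ^\<^sub>m k)\<^sup>T = A\<^sup>T ^\<^sub>m k"
proof (induction k)
  case (Suc k)
  have "(A ^\<^sub>m Suc k)\<^sup>T = A\<^sup>T * A\<^sup>T ^\<^sub>m k"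
    using A transpose_mult[of "A ^\<^sub>m k" n n A n] by (simp add: Suc)
  then show ?case using pow_mat_commute[of "A\<^sup>T" n k] A by simp
qed (use A in simp)

lemma transpose_poly_mat:
  assumes A: "A \<in> carrier_mat n n" and sym: "A\<^sup>T = A"
  shows "(poly_mat p A)\<^sup>T = poly_mat p A"
proof (intro eq_matI)
  fix i j assume "i < dim_row (poly_mat p A)" "j < dim_col (poly_mat p A)"
  then have ij: "i < n" "j < n" using A by auto
  have "(A ^\<^sub>m k) $$ (j, i) = (A ^\<^sub>m k) $$ (i, j)" for k
    using A ij transpose_pow_mat[OF A, of k] index_transpose_mat(1)[of i "A ^\<^sub>m k" j]
    by (simp add: sym)
  then show "(poly_mat p A)\<^sup>T $$ (i, j) = poly_mat p A $$ (i, j)"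
    using A ij by (simp add: poly_mat_index[OF A _ _ order.refl])
qed (use A in auto)

lemma poly_mat_scalar_prod:
  assumes A: "A \<in> carrier_mat n n" and sym: "A\<^sup>T = A"
    and v: "v \<in> carrier_vec n" and w: "w \<in> carrier_vec n"
  shows "v \<bullet> (poly_mat p A *\<^sub>v w) = (poly_mat p A *\<^sub>v v) \<bullet> w"
  using transpose_vec_mult_scalar[of "poly_mat p A" n n w v] A v w
  by (simp add: transpose_poly_mat[OF A sym])

text \<open>The source of all positivity below: the quadratic form of a square is a squared
  norm.\<close>

lemma poly_mat_square_scalar_prod:
  assumes A: "A \<in> carrier_mat n n" and sym: "A\<^sup>T = A" and v: "v \<in> carrier_vec n"
  shows "v \<bullet> (poly_mat (p * p) A *\<^sub>v v) = (poly_mat p A *\<^sub>v v) \<bullet> (poly_mat p A *\<^sub>v v)"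
  using poly_mat_scalar_prod[OF A sym v, of "poly_mat p A *\<^sub>v v" p] A v
  by (simp add: poly_mat_mult_vec[OF A v] mult_mat_vec_carrier[of _ n n])

lemma real_scalar_prod_ge_0: "(v :: real vec) \<bullet> v \<ge> 0"
  by (auto simp: scalar_prod_def intro: sum_nonneg)

lemma real_scalar_prod_eq_0:
  assumes "(v :: real vec) \<in> carrier_vec n" "v \<bullet> v = 0"
  shows "v = 0\<^sub>v n"
  using assms by (intro eq_vecI) (auto simp: scalar_prod_def sum_nonneg_eq_0_iff)

section \<open>Positive semidefiniteness from nonnegativity on the spectrum\<close>

lemma poly_mat_annihilator_exists:
  assumes A: "A \<in> carrier_mat n n" and v: "v \<in> carrier_vec n"
  shows "\<exists>f. f \<noteq> 0 \<and> poly_mat f A *\<^sub>v v = 0\<^sub>v n"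
proof -
  \<comment> \<open>The coefficients of \<open>f\<close> form a kernel vector of the matrix with columns \<open>A\<^sup>k v\<close> for
    \<open>k \<le> n\<close>, made square by a zero row.\<close>
  define c where "c i = vec (Suc n) (\<lambda>k. (A ^\<^sub>m k *\<^sub>v v) $ i)" for i
  define B where "B = mat\<^sub>r (Suc n) (Suc n) (\<lambda>i. if i = n then 0\<^sub>v (Suc n) else c i)"
  have "det B = 0"
    unfolding B_def by (rule det_row_0) (auto simp: c_def)
  moreover have "B \<in> carrier_mat (Suc n) (Suc n)" by (simp add: B_def)
  ultimately obtain u where u: "u \<in> carrier_vec (Suc n)" "u \<noteq> 0\<^sub>v (Suc n)" "B *\<^sub>v u = 0\<^sub>v (Suc n)"
    using det_0_iff_vec_prod_zero by blast
  define f where "f = (\<Sum>k\<le>n. Polynomial.monom (u $ k) k)"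
  have cf: "coeff f k = (if k \<le> n then u $ k else 0)" for k
    unfolding f_def by (simp add: coeff_sum)
  have "f \<noteq> 0"
  proof
    assume "f = 0"
    then have "u $ k = 0" if "k < Suc n" for k using cf[of k] that by simp
    then have "u = 0\<^sub>v (Suc n)" using u(1) by (intro eq_vecI) auto
    then show False using u by simp
  qed
  moreover have "poly_mat f A *\<^sub>v v = 0\<^sub>v n"
  proof (intro eq_vecI)
    fix i assume "i < dim_vec (0\<^sub>v n :: real vec)"
    then have i: "i < n" by simp
    have deg: "degree f \<le> n" by (rule degree_le) (simp add: cf)
    have "(poly_mat f A *\<^sub>v v) $ i = (\<Sum>j<n. \<Sum>k\<le>n. u $ k * (A ^\<^sub>m k) $$ (i, j) * v $ j)"
      using A v i by (auto simp: scalar_prod_def lessThan_atLeast0 poly_mat_index[OF A _ _ deg] cf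
          sum_distrib_right intro!: sum.cong)
    also have "\<dots> = (\<Sum>k\<le>n. (A ^\<^sub>m k *\<^sub>v v) $ i * u $ k)"
      using A v i by (subst sum.swap) (auto simp: scalar_prod_def lessThan_atLeast0
          sum_distrib_left sum_distrib_right algebra_simps intro!: sum.cong)
    also have "\<dots> = (B *\<^sub>v u) $ i"
      using i u(1) by (auto simp: B_def c_def scalar_prod_def atLeast0_lessThan_Suc
          simp flip: lessThan_atLeast0 lessThan_Suc_atMost intro!: sum.cong)
    also have "\<dots> = 0" using u(3) i by simp
    finally show "(poly_mat f A *\<^sub>v v) $ i = 0\<^sub>v n $ i" using i by simp
  qed (use A in auto)
  ultimately show ?thesis by blast
qed

text \<open>The quadratic has the roots \<open>z\<close> and its conjugate. Modulo it,
  \<open>f\<close> leaves a real remainder of degree at most 1 that vanishes at the nonreal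
  \<open>z\<close>, hence is zero.\<close>

lemma real_quadratic_dvd_of_complex_root:
  fixes f :: "real poly"
  assumes root: "poly (map_poly of_real f) z = 0" and im: "Im z \<noteq> 0"
  shows "[:(Re z)\<^sup>2 + (Im z)\<^sup>2, - 2 * Re z, 1:] dvd f"
proof -
  interpret h: map_poly_comm_ring_hom complex_of_real ..
  define d where "d = [:(Re z)\<^sup>2 + (Im z)\<^sup>2, - 2 * Re z, 1:]"
  have d0: "poly (map_poly complex_of_real d) z = 0"
    by (simp add: d_def map_poly_pCons complex_eq_iff power2_eq_square algebra_simps)
  define g where "g = f mod d"
  have "degree d = 2" by (simp add: d_def)
  then have "degree g < 2 \<or> g = 0" using degree_mod_less'[of d f] unfolding g_def by force
  then have "degree g \<le> 1" by auto
  then obtain a b where g: "g = [:a, b:]"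
    by (metis degree1_coeffs degree_eq_zeroE le_neq_implies_less less_one pCons_0_0)
  have "f = d * (f div d) + g" by (simp add: g_def)
  then have "poly (map_poly complex_of_real f) z =
      poly (map_poly of_real d) z * poly (map_poly of_real (f div d)) z + poly (map_poly of_real g) z"
    by (metis h.hom_add h.hom_mult poly_add poly_mult)
  then have "poly (map_poly complex_of_real g) z = 0" using d0 root by simp
  then have "complex_of_real a + of_real b * z = 0"
    by (cases "b = 0"; cases "a = 0") (simp_all add: g map_poly_pCons mult.commute)
  \<comment> \<open>The imaginary part of \<open>a + b z\<close> is \<open>b * Im z\<close>, so
    \<open>b = 0\<close> and then \<open>a = 0\<close>.\<close>
  then have "g = 0" using im by (auto simp: g complex_eq_iff)
  then show ?thesis unfolding d_def[symmetric] g_def by (simp add: dvd_eq_mod_eq_0)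
qed

text \<open>Newton interpolation: a multiple of the node polynomial \<open>m\<close> corrects the
  value at the new point and keeps the old ones.\<close>

lemma poly_interpolation_exists:
  fixes y :: "'a :: field \<Rightarrow> 'a"
  assumes "finite S"
  shows "\<exists>r. \<forall>c\<in>S. poly r c = y c"
  using assms
proof (induction S)
  case (insert a S)
  then obtain r where r: "\<forall>c\<in>S. poly r c = y c" by blast
  define m where "m = (\<Prod>c\<in>S. [:- c, 1:])"
  have m: "poly m c = 0" if "c \<in> S" for c
    using that insert.hyps by (auto simp: m_def poly_prod)
  have ma: "poly m a \<noteq> 0" using insert.hyps by (auto simp: m_def poly_prod)
  have "\<forall>c\<in>insert a S. poly (r + Polynomial.smult ((y a - poly r a) / poly m a) m) c = y c"
    using r m ma by auto
  then show ?case by blast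
qed simp

lemma prod_linear_dvd:
  fixes f :: "'a :: field poly"
  assumes "finite S" "\<forall>c\<in>S. poly f c = 0"
  shows "(\<Prod>c\<in>S. [:- c, 1:]) dvd f"
  using assms
proof (induction S)
  case (insert a S)
  then obtain g where g: "f = (\<Prod>c\<in>S. [:- c, 1:]) * g" by (auto elim: dvdE)
  have "poly (\<Prod>c\<in>S. [:- c, 1:]) a \<noteq> 0" using insert.hyps by (auto simp: poly_prod)
  then have "poly g a = 0" using insert.prems g by simp
  then have "[:- a, 1:] dvd g" by (simp add: poly_eq_0_iff_dvd)
  then have "(\<Prod>c\<in>S. [:- c, 1:]) * [:- a, 1:] dvd f" unfolding g by (rule mult_dvd_mono[OF dvd_refl])
  then show ?case using insert.hyps by (simp add: mult.commute)
qed simp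

text \<open>Factors of \<open>f\<close> are stripped off by induction on the degree. Symmetry of
  \<open>A\<close> makes repeated real factors and nonreal conjugate pairs redundant, and a linear
  factor at a number that is not an eigenvalue acts injectively. What remains is a product of
  distinct linear factors at eigenvalues.\<close>

lemma symmetric_annihilator_splits:
  assumes A: "A \<in> carrier_mat n n" and sym: "A\<^sup>T = A"
    and "v \<in> carrier_vec n" "f \<noteq> 0" "poly_mat f A *\<^sub>v v = 0\<^sub>v n"
  shows "\<exists>S. finite S \<and> (\<forall>c\<in>S. eigenvalue A c) \<and>
    poly_mat (\<Prod>c\<in>S. [:- c, 1:]) A *\<^sub>v v = 0\<^sub>v n"
  using assms(3-5)
proof (induction "degree f" arbitrary: f v rule: less_induct)
  case less
  note v = less.prems(1)
  have carr [simp]: "poly_mat p A *\<^sub>v w \<in> carrier_vec n" if "w \<in> carrier_vec n" for p w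
    using A that by (simp add: mult_mat_vec_carrier[of _ n n])
  have zero [simp]: "poly_mat p A *\<^sub>v 0\<^sub>v n = 0\<^sub>v n" for p
    using A by (intro eq_vecI) (auto simp: scalar_prod_def)
  show ?case
  proof (cases "degree f = 0")
    case True
    then obtain a where a: "f = [:a:]" by (rule degree_eq_zeroE)
    have "a \<cdot>\<^sub>v v = 0\<^sub>v n" using less.prems a by (simp add: poly_mat_const_vec[OF A v])
    then have "v $ i = 0" if "i < n" for i
      using that v less.prems(2) a index_smult_vec(1)[of i v a] by auto
    then have "v = 0\<^sub>v n" using v by (intro eq_vecI) auto
    then show ?thesis by (intro exI[of _ "{}"]) simp
  next
    case False
    then have "\<not> constant (poly (map_poly complex_of_real f))"
      by (simp add: constant_degree)
    then obtain z where z: "poly (map_poly complex_of_real f) z = 0"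
      using fundamental_theorem_of_algebra by blast
    show ?thesis
    proof (cases "Im z = 0")
      case True
      define c where "c = Re z"
      have "z = of_real c" using True by (simp add: c_def complex_eq_iff)
      then have "poly f c = 0" using z by simp
      then obtain g where g: "f = [:- c, 1:] * g" by (auto simp: poly_eq_0_iff_dvd elim: dvdE)
      \<comment> \<open>The cofactor \<open>g\<close> annihilates \<open>w\<close>, so the induction
        hypothesis yields a product \<open>M\<close> for \<open>w\<close>; then
        \<open>[:- c, 1:] * M\<close> annihilates \<open>v\<close>.\<close>
      define w where "w = poly_mat [:- c, 1:] A *\<^sub>v v"
      have w: "w \<in> carrier_vec n" using v by (simp add: w_def)
      have g0: "g \<noteq> 0" using g less.prems by auto
      have "degree f = Suc (degree g)" unfolding g using g0 by (subst degree_mult_eq) auto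
      moreover have "poly_mat g A *\<^sub>v w = 0\<^sub>v n"
        using less.prems(3) unfolding w_def
        by (simp only: poly_mat_mult_vec[OF A v, symmetric] g mult.commute[of g])
      ultimately obtain S where S: "finite S" "\<forall>c\<in>S. eigenvalue A c"
        "poly_mat (\<Prod>c\<in>S. [:- c, 1:]) A *\<^sub>v w = 0\<^sub>v n"
        using less.hyps[of g w] w g0 by auto
      define M where "M = (\<Prod>c\<in>S. [:- c, 1:])"
      define u where "u = poly_mat M A *\<^sub>v v"
      have u: "u \<in> carrier_vec n" using v by (simp add: u_def)
      have lu: "poly_mat [:- c, 1:] A *\<^sub>v u = 0\<^sub>v n"
        using S(3) unfolding u_def w_def M_def[symmetric]
        by (simp only: poly_mat_mult_vec[OF A v, symmetric] mult.commute[of M])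
      consider "c \<in> S" | "c \<notin> S" "eigenvalue A c" | "\<not> eigenvalue A c" by blast
      then show ?thesis
      proof cases
        case 1
        \<comment> \<open>A repeated factor: with \<open>u = (A - c) u'\<close> and
          \<open>(A - c) u = 0\<close>, symmetry gives
          \<open>u \<bullet> u = u' \<bullet> (A - c) u = 0\<close>. Hence \<open>M\<close> alone
          already annihilates \<open>v\<close>.\<close>
        define M' where "M' = (\<Prod>c\<in>S - {c}. [:- c, 1:])"
        have M: "M = [:- c, 1:] * M'" using S(1) 1 by (simp add: M_def M'_def prod.remove)
        define u' where "u' = poly_mat M' A *\<^sub>v v"
        have u': "u' \<in> carrier_vec n" using v by (simp add: u'_def)
        have uu': "u = poly_mat [:- c, 1:] A *\<^sub>v u'"
          by (simp only: u_def u'_def M poly_mat_mult_vec[OF A v])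
        have "u \<bullet> u = u' \<bullet> (poly_mat [:- c, 1:] A *\<^sub>v u)"
          using poly_mat_square_scalar_prod[OF A sym u', of "[:- c, 1:]"]
          by (simp only: uu' poly_mat_mult_vec[OF A u'])
        also have "\<dots> = 0" using lu u' by simp
        finally have "u = 0\<^sub>v n" using real_scalar_prod_eq_0[OF u] by blast
        then show ?thesis using S unfolding u_def M_def by blast
      next
        case 2
        have "poly_mat (\<Prod>c\<in>insert c S. [:- c, 1:]) A *\<^sub>v v = 0\<^sub>v n"
          using lu S(1) 2(1) by (simp add: u_def M_def poly_mat_mult_vec[OF A v] del: mult_pCons_left)
        then show ?thesis using S 2 by (intro exI[of _ "insert c S"]) auto
      next
        \<comment> \<open>Here \<open>A - c\<close> is injective, so \<open>(A - c) u = 0\<close>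
          forces \<open>u = 0\<close>.\<close>
        case 3
        have "A *\<^sub>v u = c \<cdot>\<^sub>v u"
        proof (intro eq_vecI)
          fix i assume "i < dim_vec (c \<cdot>\<^sub>v u)"
          then have "i < n" using u by simp
          then show "(A *\<^sub>v u) $ i = (c \<cdot>\<^sub>v u) $ i"
            using arg_cong[OF lu, of "\<lambda>x. x $ i"] A u
            by (simp add: poly_mat_linear_vec[OF A u])
        qed (use A u in auto)
        then have "u = 0\<^sub>v n"
          using 3 A u unfolding eigenvalue_def eigenvector_def by auto
        then show ?thesis using S unfolding u_def M_def by blast
      qed
    next
      case False
      \<comment> \<open>Completing the square writes the quadratic factor as
        \<open>l\<^sup>2\<close> plus a positive constant. Its value at \<open>A\<close> is positive
        definite, so it can be cancelled and \<open>g\<close> already annihilates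
        \<open>v\<close>.\<close>
      define l where "l = [:- Re z, 1:]"
      define d where "d = l * l + [:(Im z)\<^sup>2:]"
      have d: "d = [:(Re z)\<^sup>2 + (Im z)\<^sup>2, - 2 * Re z, 1:]"
        by (simp add: d_def l_def power2_eq_square)
      obtain g where g: "f = d * g"
        using real_quadratic_dvd_of_complex_root[OF z False] unfolding d by (auto elim: dvdE)
      have g0: "g \<noteq> 0" using g less.prems by auto
      have deg: "degree f = degree g + 2" unfolding g d using g0 by (subst degree_mult_eq) auto
      define u where "u = poly_mat g A *\<^sub>v v"
      have u: "u \<in> carrier_vec n" using v by (simp add: u_def)
      have "poly_mat d A *\<^sub>v u = 0\<^sub>v n"
        using less.prems(3) unfolding u_def g by (simp only: poly_mat_mult_vec[OF A v])
      then have "0 = u \<bullet> (poly_mat (l * l) A *\<^sub>v u + poly_mat [:(Im z)\<^sup>2:] A *\<^sub>v u)"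
        using u by (simp add: d_def poly_mat_add_vec[OF A u, symmetric])
      also have "\<dots> = u \<bullet> (poly_mat (l * l) A *\<^sub>v u) + (Im z)\<^sup>2 * (u \<bullet> u)"
        using u by (simp add: scalar_prod_add_distrib[of _ n] poly_mat_const_vec[OF A u])
      also have "\<dots> \<ge> (Im z)\<^sup>2 * (u \<bullet> u)"
        by (simp add: poly_mat_square_scalar_prod[OF A sym u] real_scalar_prod_ge_0)
      finally have "(Im z)\<^sup>2 * (u \<bullet> u) \<le> 0" .
      then have "u \<bullet> u \<le> 0" using False by (simp add: mult_le_0_iff)
      then have "u = 0\<^sub>v n" using real_scalar_prod_eq_0[OF u] real_scalar_prod_ge_0[of u] by linarith
      then show ?thesis using less.hyps[of g v] v g0 deg unfolding u_def by simp
    qed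
  qed
qed

lemma poly_mat_nonneg:
  assumes A: "A \<in> carrier_mat n n" and sym: "A\<^sup>T = A" and v: "v \<in> carrier_vec n"
    and q: "\<And>c. eigenvalue A c \<Longrightarrow> poly q c \<ge> 0"
  shows "v \<bullet> (poly_mat q A *\<^sub>v v) \<ge> 0"
proof -
  obtain S where S: "finite S" "\<forall>c\<in>S. eigenvalue A c"
    "poly_mat (\<Prod>c\<in>S. [:- c, 1:]) A *\<^sub>v v = 0\<^sub>v n"
    using poly_mat_annihilator_exists[OF A v] symmetric_annihilator_splits[OF A sym v] by blast
  obtain r where r: "\<forall>c\<in>S. poly r c = sqrt (poly q c)"
    using poly_interpolation_exists[OF S(1), of "\<lambda>c. sqrt (poly q c)"] by blast
  \<comment> \<open>All points of \<open>S\<close> are eigenvalues, where \<open>q\<close> is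
    nonnegative; so \<open>r * r\<close> agrees with \<open>q\<close> on \<open>S\<close>.\<close>
  have "(\<Prod>c\<in>S. [:- c, 1:]) dvd q - r * r"
    using S r q by (intro prod_linear_dvd) auto
  then obtain h where "q - r * r = (\<Prod>c\<in>S. [:- c, 1:]) * h" by (rule dvdE)
  then have h: "q = r * r + h * (\<Prod>c\<in>S. [:- c, 1:])" by (simp add: algebra_simps)
  have "poly_mat h A *\<^sub>v 0\<^sub>v n = 0\<^sub>v n"
    using A by (intro eq_vecI) (auto simp: scalar_prod_def)
  then have "poly_mat q A *\<^sub>v v = poly_mat (r * r) A *\<^sub>v v"
    using A v S(3) by (simp add: h poly_mat_add_vec[OF A v] poly_mat_mult_vec[OF A v]
        mult_mat_vec_carrier[of _ n n])
  then show ?thesis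
    by (simp add: poly_mat_square_scalar_prod[OF A sym v] real_scalar_prod_ge_0)
qed

section \<open>The ratio bound\<close>

text \<open>The form is evaluated at the part of \<open>x\<close> orthogonal to the all-ones vector,
  where it is nonnegative; the part along that eigenvector contributes exactly the left-hand side,
  divided by \<open>n\<close>.\<close>

lemma poly_mat_constant_row_sum_bound:
  assumes A: "A \<in> carrier_mat n n" and sym: "A\<^sup>T = A" and x: "x \<in> carrier_vec n"
    and ones: "A *\<^sub>v vec n (\<lambda>_. 1) = d \<cdot>\<^sub>v vec n (\<lambda>_. 1)"
    and q: "\<And>c. eigenvalue A c \<Longrightarrow> poly q c \<ge> 0"
  shows "poly q d * (\<Sum>i<n. x $ i)\<^sup>2 \<le> n * (x \<bullet> (poly_mat q A *\<^sub>v x))"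
proof (cases "n = 0")
  case False
  define e where "e = (vec n (\<lambda>_. 1) :: real vec)"
  define s where "s = (\<Sum>i<n. x $ i)"
  \<comment> \<open>The mean \<open>s / n\<close> is the coefficient of the orthogonal projection of
    \<open>x\<close> onto \<open>e\<close>.\<close>
  define z where "z = x - (s / n) \<cdot>\<^sub>v e"
  let ?Q = "poly_mat q A"
  have e: "e \<in> carrier_vec n" and z: "z \<in> carrier_vec n" using x by (auto simp: e_def z_def)
  have Q: "?Q \<in> carrier_mat n n" using A by simp
  note carr = mult_mat_vec_carrier[OF Q]
  have Qe: "?Q *\<^sub>v e = poly q d \<cdot>\<^sub>v e"
    using poly_mat_eigenvector[OF A e] ones unfolding e_def by blast
  have xe: "x \<bullet> e = s" and ee: "e \<bullet> e = n"
    by (simp_all add: e_def scalar_prod_def s_def lessThan_atLeast0)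
  have ex: "e \<bullet> (?Q *\<^sub>v x) = poly q d * s"
    using poly_mat_scalar_prod[OF A sym e x] x e xe by (simp add: Qe comm_scalar_prod[OF e x])
  have Qz: "?Q *\<^sub>v z = ?Q *\<^sub>v x - (s / n * poly q d) \<cdot>\<^sub>v e"
    using e x by (simp add: z_def mult_minus_distrib_mat_vec[OF Q] mult_mat_vec[OF Q] Qe
        smult_smult_assoc)
  have "0 \<le> z \<bullet> (?Q *\<^sub>v z)" by (rule poly_mat_nonneg[OF A sym z q])
  also have "\<dots> = x \<bullet> (?Q *\<^sub>v z) - s / n * (e \<bullet> (?Q *\<^sub>v z))"
    using e x z carr by (simp add: z_def minus_scalar_prod_distrib[of _ n])
  \<comment> \<open>The last bracket is \<open>e \<bullet> (?Q *\<^sub>v z)\<close>, which cancels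
    to 0 in the next step because \<open>z\<close> is orthogonal to the eigenvector
    \<open>e\<close>.\<close>
  also have "\<dots> = x \<bullet> (?Q *\<^sub>v x) - s / n * poly q d * s -
      s / n * (poly q d * s - s / n * poly q d * n)"
    using e x carr by (simp add: Qz scalar_prod_minus_distrib[of _ n] xe ee ex)
  also have "\<dots> = x \<bullet> (?Q *\<^sub>v x) - poly q d * s\<^sup>2 / n"
    using False by (simp add: power2_eq_square field_simps)
  finally show ?thesis using False by (simp add: s_def field_simps)
qed simp

text \<open>Hoffman's ratio bound with \<open>p(A)\<close> in place of \<open>A\<close>: the
  previous lemma is applied to the indicator vector of \<open>U\<close>.\<close>

lemma independent_set_ratio_bound:
  assumes A: "A \<in> carrier_mat n n" and sym: "A\<^sup>T = A"
    and ones: "A *\<^sub>v vec n (\<lambda>_. 1) = d \<cdot>\<^sub>v vec n (\<lambda>_. 1)"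
    and l: "\<And>c. eigenvalue A c \<Longrightarrow> l \<le> poly p c"
    and U: "U \<subseteq> {..<n}" "U \<noteq> {}"
    and diag: "\<And>i. i \<in> U \<Longrightarrow> poly_mat p A $$ (i, i) \<le> W"
    and off: "\<And>i j. i \<in> U \<Longrightarrow> j \<in> U \<Longrightarrow> i \<noteq> j \<Longrightarrow> poly_mat p A $$ (i, j) = 0"
  shows "card U * (poly p d - l) \<le> n * (W - l)"
proof -
  define x where "x = vec n (\<lambda>i. if i \<in> U then 1 else 0 :: real)"
  \<comment> \<open>Subtracting \<open>l\<close> makes the polynomial nonnegative on the spectrum,
    as the previous lemma demands.\<close>
  define q where "q = p + [:- l:]"
  have x: "x \<in> carrier_vec n" by (simp add: x_def)
  have fin: "finite U" using U finite_subset by blast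
  \<comment> \<open>Weighting by the indicator vector restricts a sum to \<open>U\<close>; used
    twice, it cuts the quadratic form down to the block of \<open>U\<close>.\<close>
  have sumU: "(\<Sum>j<n. f j * x $ j) = sum f U" for f
    by (rule sum.mono_neutral_cong_right) (use U in \<open>auto simp: x_def\<close>)
  have sumx: "(\<Sum>i<n. x $ i) = card U"
    using sumU[of "\<lambda>_. 1"] by simp
  have "x \<bullet> (poly_mat p A *\<^sub>v x) = (\<Sum>i<n. (\<Sum>j<n. poly_mat p A $$ (i, j) * x $ j) * x $ i)"
    using A x by (auto simp: scalar_prod_def lessThan_atLeast0 mult.commute[of "x $ _"]
        intro!: sum.cong)
  also have "\<dots> = (\<Sum>i\<in>U. \<Sum>j\<in>U. poly_mat p A $$ (i, j))"
    by (simp only: sumU)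
  also have "\<dots> = (\<Sum>i\<in>U. poly_mat p A $$ (i, i))"
  proof (intro sum.cong refl)
    fix i assume i: "i \<in> U"
    have "(\<Sum>j\<in>U. poly_mat p A $$ (i, j)) = (\<Sum>j\<in>U. if j = i then poly_mat p A $$ (i, i) else 0)"
      using i off by (intro sum.cong) auto
    then show "(\<Sum>j\<in>U. poly_mat p A $$ (i, j)) = poly_mat p A $$ (i, i)"
      using fin i by simp
  qed
  also have "\<dots> \<le> card U * W" using diag by (intro sum_bounded_above)
  finally have xpx: "x \<bullet> (poly_mat p A *\<^sub>v x) \<le> card U * W" .
  have "x \<bullet> x = (\<Sum>j<n. x $ j * x $ j)" using x by (simp add: scalar_prod_def lessThan_atLeast0)
  also have "\<dots> = (\<Sum>j\<in>U. x $ j)" by (rule sumU)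
  also have "\<dots> = (\<Sum>j\<in>U. 1)" using U by (intro sum.cong) (auto simp: x_def)
  finally have xx: "x \<bullet> x = card U" by simp
  have "poly q d * (card U)\<^sup>2 \<le> n * (x \<bullet> (poly_mat q A *\<^sub>v x))"
    using poly_mat_constant_row_sum_bound[OF A sym x ones, of q] l by (simp add: q_def sumx)
  also have "x \<bullet> (poly_mat q A *\<^sub>v x) = x \<bullet> (poly_mat p A *\<^sub>v x) - l * card U"
    using A x by (simp add: q_def poly_mat_add_vec[OF A x] poly_mat_const_vec[OF A x]
        scalar_prod_add_distrib[of _ n] mult_mat_vec_carrier[of _ n n] xx)
  also have "n * \<dots> \<le> n * (card U * W - l * card U)"
    using xpx by (intro mult_left_mono) auto
  \<comment> \<open>Both sides carry a factor \<open>card U\<close>, which is positive since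
    \<open>U\<close> is nonempty and finite.\<close>
  finally have "card U * (card U * (poly p d - l)) \<le> card U * (n * (W - l))"
    by (simp add: q_def power2_eq_square algebra_simps)
  moreover have "real (card U) > 0" using U fin by (simp add: card_gt_0_iff)
  ultimately show ?thesis by (simp only: mult_le_cancel_left_pos)
qed

section \<open>Eigenvalues in the ordered list, and the largest one\<close>

text \<open>The eigenvector equation is read off at a coordinate of largest absolute value, where
  the row sum dominates.\<close>

lemma eigenvalue_le_row_sum:
  fixes A :: "real mat"
  assumes A: "A \<in> carrier_mat n n" and nonneg: "\<And>i j. i < n \<Longrightarrow> j < n \<Longrightarrow> A $$ (i, j) \<ge> 0"
    and row: "\<And>i. i < n \<Longrightarrow> (\<Sum>j<n. A $$ (i, j)) = d" and ev: "eigenvalue A c"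
  shows "c \<le> d"
proof -
  obtain v where v: "v \<in> carrier_vec n" "v \<noteq> 0\<^sub>v n" "A *\<^sub>v v = c \<cdot>\<^sub>v v"
    using ev A unfolding eigenvalue_def eigenvector_def by auto
  obtain k where k: "k < n" "v $ k \<noteq> 0" using v(1,2) by (metis carrier_vecD eq_vecI index_zero_vec)
  have "finite {..<n}" "{..<n} \<noteq> {}" using k by auto
  then obtain i where i: "i < n" and max: "\<And>j. j < n \<Longrightarrow> \<bar>v $ j\<bar> \<le> \<bar>v $ i\<bar>"
    using Max_in[of "(\<lambda>i. \<bar>v $ i\<bar>) ` {..<n}"] Max_ge[of "(\<lambda>i. \<bar>v $ i\<bar>) ` {..<n}"] by fastforce
  have pos: "\<bar>v $ i\<bar> > 0" using max[OF k(1)] k(2) by linarith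
  have "c * v $ i = (\<Sum>j<n. A $$ (i, j) * v $ j)"
    using arg_cong[OF v(3), of "\<lambda>x. x $ i"] A v(1) i by (simp add: scalar_prod_def lessThan_atLeast0)
  \<comment> \<open>Only an inequality, since \<open>c\<close> may be negative.\<close>
  then have "c * \<bar>v $ i\<bar> \<le> \<bar>\<Sum>j<n. A $$ (i, j) * v $ j\<bar>"
    by (metis abs_ge_self abs_mult mult_right_mono abs_ge_zero)
  also have "\<dots> \<le> (\<Sum>j<n. A $$ (i, j) * \<bar>v $ i\<bar>)"
    using i nonneg max by (intro order.trans[OF sum_abs] sum_mono)
      (auto simp: abs_mult intro!: mult_left_mono)
  also have "\<dots> = d * \<bar>v $ i\<bar>" using row[OF i] by (simp flip: sum_distrib_right)
  finally show ?thesis using pos by simp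
qed

text \<open>Every eigenvalue is a root of the characteristic polynomial and hence is listed; the
  list is no longer than the degree \<open>n\<close>, which bounds the index.\<close>

lemma eigenvalue_eq_eigval:
  assumes A: "A \<in> carrier_mat n n" and c: "eigenvalue A c"
  shows "\<exists>i. 1 \<le> i \<and> i \<le> n \<and> c = eigval A i"
proof -
  let ?xs = "rev (sorted_list_of_multiset (proots (char_poly A)))"
  have deg: "degree (char_poly A) = n" "char_poly A \<noteq> 0" using degree_monic_char_poly[OF A] by auto
  have "c \<in> set ?xs" using c deg by (simp add: eigenvalue_root_char_poly[OF A])
  then obtain k where k: "k < length ?xs" "c = ?xs ! k" by (metis in_set_conv_nth)
  have "length ?xs = size (proots (char_poly A))"
    by (metis length_rev mset_sorted_list_of_multiset size_mset)
  then have "k < n" using k(1) size_proots_le[of "char_poly A"] deg by simp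
  then show ?thesis using k by (intro exI[of _ "Suc k"]) (simp add: eigval_def)
qed

lemma eigval_1_eq:
  assumes A: "A \<in> carrier_mat n n" and d: "eigenvalue A d"
    and max: "\<And>c. eigenvalue A c \<Longrightarrow> c \<le> d"
  shows "eigval A 1 = d"
proof -
  let ?ys = "sorted_list_of_multiset (proots (char_poly A))"
  have nz: "char_poly A \<noteq> 0" using degree_monic_char_poly[OF A] by auto
  have set: "set ?ys = {c. eigenvalue A c}" using nz by (auto simp: eigenvalue_root_char_poly[OF A])
  then have ne: "?ys \<noteq> []" using d by fastforce
  obtain j where j: "j < length ?ys" "?ys ! j = d" using d set by (metis in_set_conv_nth mem_Collect_eq)
  have "sorted ?ys" by simp
  then have "d \<le> last ?ys"
    using j ne sorted_nth_mono[of ?ys j "length ?ys - 1"] by (simp add: last_conv_nth)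
  moreover have "last ?ys \<le> d" using max last_in_set[OF ne] set by blast
  moreover have "eigval A 1 = last ?ys" using ne by (simp add: eigval_def rev_nth last_conv_nth)
  ultimately show ?thesis by simp
qed

section \<open>Line graphs and distance colourings\<close>

lemma line_graph_edge_iff:
  "{e, f} \<in> line_graph_edges E \<longleftrightarrow> e \<in> E \<and> f \<in> E \<and> e \<noteq> f \<and> e \<inter> f \<noteq> {}"
  unfolding line_graph_edges_def by (auto simp: doubleton_eq_iff)

text \<open>The neighbours of an edge \<open>{u, v}\<close> are the other edges at \<open>u\<close>
  and the other edges at \<open>v\<close>. These sets are disjoint as no second edge joins
  \<open>u\<close> and \<open>v\<close>. The subtraction is exact: \<open>e\<close> itself gives
  \<open>k \<ge> 1\<close>.\<close>

lemma line_graph_degree: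
  assumes G: "finite_simple_graph V E" and reg: "\<forall>v\<in>V. vertex_degree E v = k" and e: "e \<in> E"
  shows "card {f \<in> E. {e, f} \<in> line_graph_edges E} = 2 * (k - 1)"
proof -
  have finV: "finite V" and sub: "\<And>f. f \<in> E \<Longrightarrow> f \<subseteq> V \<and> card f = 2"
    using G unfolding finite_simple_graph_def by auto
  have finE: "finite E" by (rule finite_subset[of _ "Pow V"]) (use finV sub in auto)
  obtain u v where uv: "e = {u, v}" "u \<noteq> v" using sub[OF e] card_2_iff by metis
  let ?N = "\<lambda>x. {f \<in> E. x \<in> f} - {e}"
  have card: "card (?N x) = k - 1" if "x \<in> e" for x
  proof -
    have "x \<in> V" using that e sub by blast
    then show ?thesis using that reg e by (simp add: vertex_degree_def)
  qed
  have "?N u \<inter> ?N v = {}"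
  proof (rule ccontr)
    assume "?N u \<inter> ?N v \<noteq> {}"
    then obtain f where f: "f \<in> E" "u \<in> f" "v \<in> f" "f \<noteq> e" by blast
    have "finite f" using sub[OF f(1)] by (metis card.infinite zero_neq_numeral)
    then have "e = f" using f uv sub[OF f(1)] by (intro card_subset_eq) auto
    then show False using f by simp
  qed
  moreover have "{f \<in> E. {e, f} \<in> line_graph_edges E} = ?N u \<union> ?N v"
    using e uv by (auto simp: line_graph_edge_iff)
  ultimately show ?thesis
    using card[of u] card[of v] uv finE by (simp add: card_Un_disjoint)
qed

section \<open>Adjacency matrices, walks and distance\<close>

lemma adjacency_matrix_carrier [simp]:
  "adjacency_matrix vs E \<in> carrier_mat (length vs) (length vs)"
  by (simp add: adjacency_matrix_def)

lemma adjacency_matrix_index: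
  "i < length vs \<Longrightarrow> j < length vs \<Longrightarrow>
    adjacency_matrix vs E $$ (i, j) = (if {vs ! i, vs ! j} \<in> E then 1 else 0)"
  by (simp add: adjacency_matrix_def)

lemma transpose_adjacency_matrix: "(adjacency_matrix vs E)\<^sup>T = adjacency_matrix vs E"
  by (intro eq_matI) (auto simp: adjacency_matrix_def insert_commute)

lemma adjacency_matrix_row_sum:
  assumes "distinct vs" "i < length vs"
  shows "(\<Sum>j<length vs. adjacency_matrix vs E $$ (i, j)) = card {w \<in> set vs. {vs ! i, w} \<in> E}"
proof -
  have "(\<Sum>j<length vs. adjacency_matrix vs E $$ (i, j)) =
      (\<Sum>j<length vs. if {vs ! i, vs ! j} \<in> E then 1 else 0)"
    using assms by (intro sum.cong) (auto simp: adjacency_matrix_index)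
  also have "\<dots> = (\<Sum>w\<in>set vs. if {vs ! i, w} \<in> E then 1 else 0)"
    by (rule sum.reindex_bij_betw[OF bij_betw_nth[OF assms(1) refl refl]])
  also have "\<dots> = card {w \<in> set vs. {vs ! i, w} \<in> E}"
    by (simp add: Int_def flip: sum.inter_filter)
  finally show ?thesis .
qed

text \<open>A nonzero entry of a matrix product has a nonzero summand, whose second factor supplies
  the last step of the walk.\<close>

lemma adjacency_matrix_pow_walk:
  assumes "i < length vs" "j < length vs" "(adjacency_matrix vs E ^\<^sub>m k) $$ (i, j) \<noteq> 0"
  shows "(vs ! i, vs ! j) \<in> {(x, y). {x, y} \<in> E} ^^ k"
  using assms(2,3)
proof (induction k arbitrary: j)
  case 0
  then show ?case using assms(1) by (auto simp: adjacency_matrix_def split: if_splits)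
next
  case (Suc k)
  let ?A = "adjacency_matrix vs E"
  have A: "?A \<in> carrier_mat (length vs) (length vs)" by simp
  have "(?A ^\<^sub>m Suc k) $$ (i, j) = (\<Sum>l<length vs. (?A ^\<^sub>m k) $$ (i, l) * ?A $$ (l, j))"
    using A assms(1) Suc.prems(1) pow_carrier_mat[OF A, of k]
    by (simp add: scalar_prod_def lessThan_atLeast0 del: adjacency_matrix_carrier)
  then obtain l where l: "l < length vs" "(?A ^\<^sub>m k) $$ (i, l) * ?A $$ (l, j) \<noteq> 0"
    using Suc.prems(2) by (metis (mono_tags, lifting) lessThan_iff sum.neutral)
  then have "(vs ! i, vs ! l) \<in> {(x, y). {x, y} \<in> E} ^^ k" using Suc.IH by simp
  moreover have "{vs ! l, vs ! j} \<in> E"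
    using l Suc.prems by (auto simp: adjacency_matrix_index split: if_splits)
  ultimately show ?case by (auto simp: relcomp_unfold)
qed

lemma graph_dist_le:
  "(u, v) \<in> {(x, y). {x, y} \<in> E} ^^ k \<Longrightarrow> graph_dist E u v \<le> enat k"
  unfolding graph_dist_def by (intro Inf_lower) auto

lemma poly_mat_adjacency_eq_0:
  assumes "i < length vs" "j < length vs" "graph_dist E (vs ! i) (vs ! j) > enat (degree p)"
  shows "poly_mat p (adjacency_matrix vs E) $$ (i, j) = 0"
proof -
  have "(adjacency_matrix vs E ^\<^sub>m k) $$ (i, j) = 0" if "k \<le> degree p" for k
  proof (rule ccontr)
    assume "(adjacency_matrix vs E ^\<^sub>m k) $$ (i, j) \<noteq> 0"
    then have "graph_dist E (vs ! i) (vs ! j) \<le> enat k"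
      using assms by (intro graph_dist_le adjacency_matrix_pow_walk)
    then show False using assms(3) that by (meson enat_ord_simps(1) leD order.trans)
  qed
  then show ?thesis using assms by (simp add: poly_mat_index[OF adjacency_matrix_carrier _ _ order.refl])
qed

text \<open>An injective colouring is always admissible, so the \<open>LEAST\<close> in the
  definition ranges over a nonempty set.\<close>

lemma distance_chromatic_index_attained:
  assumes "finite E"
  shows "\<exists>c. distance_edge_colouring t E c \<and> card (c ` E) = distance_chromatic_index t E"
proof -
  obtain c :: "'a set \<Rightarrow> nat" where "inj_on c E" using finite_imp_inj_to_nat_seg[OF assms] by blast
  then have "distance_edge_colouring t E c" by (auto simp: distance_edge_colouring_def inj_on_def)
  then have "\<exists>k c. distance_edge_colouring t E c \<and> card (c ` E) = k" by blast
  then show ?thesis unfolding distance_chromatic_index_def by (rule LeastI_ex)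
qed

section \<open>The bound for the distance chromatic index\<close>

theorem theorem3p4:
  fixes V :: "'a set" and E :: "'a set set" and es :: "'a set list"
    and t :: nat and A' :: "real mat" and p :: "real poly"
  assumes "finite_simple_graph V E"
    and "regular_graph V E"
    and "t \<ge> 1"
    and "card E \<ge> 2"
    and "distinct es" and "set es = E"
    and "A' = adjacency_matrix es (line_graph_edges E)"
    and "degree p \<le> t"
    and "poly p (eigval A' 1) > min_nonprincipal p A'"
  shows "real (distance_chromatic_index t E) \<ge>
    real (card E) /
      real_of_int \<lfloor>real (card E) * ((max_diag p A' - min_nonprincipal p A') /
                                   (poly p (eigval A' 1) - min_nonprincipal p A'))\<rfloor>"
proof -
  define n where "n = length es"
  have n: "card E = n" using assms(5,6) distinct_card unfolding n_def by metis
  obtain k where k: "\<forall>v\<in>V. vertex_degree E v = k" using assms(2) unfolding regular_graph_def by blast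
  \<comment> \<open>The common degree in the line graph, shown below to be its largest
    eigenvalue.\<close>
  define d where "d = real (2 * (k - 1))"
  define l where "l = min_nonprincipal p A'"
  define W where "W = max_diag p A'"
  have A: "A' \<in> carrier_mat n n" unfolding assms(7) n_def by simp
  have sym: "A'\<^sup>T = A'" unfolding assms(7) by (rule transpose_adjacency_matrix)
  have row: "(\<Sum>j<n. A' $$ (i, j)) = d" if "i < n" for i
    using that line_graph_degree[OF assms(1) k, of "es ! i"] assms(6)
      adjacency_matrix_row_sum[OF assms(5), of i "line_graph_edges E"]
    unfolding assms(7) n_def d_def by auto
  have ones: "A' *\<^sub>v vec n (\<lambda>_. 1) = d \<cdot>\<^sub>v vec n (\<lambda>_. 1)"
    using A row by (intro eq_vecI) (auto simp: scalar_prod_def lessThan_atLeast0)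
  have "vec n (\<lambda>_. 1 :: real) \<noteq> 0\<^sub>v n"
  proof
    assume "vec n (\<lambda>_. 1 :: real) = 0\<^sub>v n"
    then have "vec n (\<lambda>_. 1 :: real) $ 0 = 0\<^sub>v n $ 0" by simp
    then show False using assms(4) n by simp
  qed
  then have "eigenvalue A' d"
    using A ones unfolding eigenvalue_def eigenvector_def
    by (intro exI[of _ "vec n (\<lambda>_. 1)"]) auto
  moreover have "c \<le> d" if "eigenvalue A' c" for c
    using eigenvalue_le_row_sum[OF A _ row that]
    by (simp add: assms(7) n_def adjacency_matrix_index)
  ultimately have eig1: "eigval A' 1 = d" by (rule eigval_1_eq[OF A])
  have gt: "poly p d > l" using assms(9) unfolding eig1 l_def .
  have l_le: "l \<le> poly p c" if c: "eigenvalue A' c" for c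
  proof -
    obtain i where i: "1 \<le> i" "i \<le> n" "c = eigval A' i" using eigenvalue_eq_eigval[OF A c] by blast
    show ?thesis
    \<comment> \<open>The minimum \<open>l\<close> ranges over indices from 2 on; index 1 is covered
      by the strict inequality \<open>gt\<close>.\<close>
    proof (cases "i = 1")
      case True
      then show ?thesis using i gt eig1 by simp
    next
      case False
      then show ?thesis
        unfolding l_def min_nonprincipal_def using i A by (intro Min_le) auto
    qed
  qed
  have W_ge: "poly_mat p A' $$ (i, i) \<le> W" if "i < n" for i
    unfolding W_def max_diag_def using that A by (intro Max_ge) auto
  define F where "F = \<lfloor>real n * ((W - l) / (poly p d - l))\<rfloor>"
  have "finite E" using assms(4) by (metis card.infinite not_numeral_le_zero)
  then obtain c where c: "distance_edge_colouring t E c" "card (c ` E) = distance_chromatic_index t E"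
    using distance_chromatic_index_attained by blast
  \<comment> \<open>The ratio bound holds for each colour class, and an integer below a real number
    is below its floor.\<close>
  have class_le: "int (card {e \<in> E. c e = a}) \<le> F" if "a \<in> c ` E" for a
  proof -
    define U where "U = {i \<in> {..<n}. c (es ! i) = a}"
    have img: "(!) es ` U = {e \<in> E. c e = a}"
      using assms(6) by (auto simp: U_def n_def in_set_conv_nth image_iff)
    have "inj_on ((!) es) U" using assms(5) by (auto simp: U_def n_def inj_on_def nth_eq_iff_index_eq)
    then have card_U: "card U = card {e \<in> E. c e = a}" using card_image img by metis
    have "U \<noteq> {}" using img that by auto
    moreover have "poly_mat p A' $$ (i, j) = 0" if "i \<in> U" "j \<in> U" "i \<noteq> j" for i j
    proof -
      have same: "c (es ! i) = c (es ! j)" using that by (simp add: U_def)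
      have "es ! i \<noteq> es ! j" "es ! i \<in> E" "es ! j \<in> E"
        using that assms(5,6) by (auto simp: U_def n_def nth_eq_iff_index_eq)
      \<comment> \<open>Distinct edges of one colour are more than \<open>t\<close> apart, hence
        beyond the reach of walks of length up to \<open>degree p\<close>.\<close>
      then have "\<not> graph_dist (line_graph_edges E) (es ! i) (es ! j) \<le> enat t"
        using c(1)[unfolded distance_edge_colouring_def] same by blast
      then have "graph_dist (line_graph_edges E) (es ! i) (es ! j) > enat (degree p)"
        using assms(8) by (meson enat_ord_simps(1) linorder_not_le order.strict_trans1)
      then show ?thesis
        using that unfolding assms(7) by (intro poly_mat_adjacency_eq_0) (auto simp: U_def n_def)
    qed
    ultimately have "card U * (poly p d - l) \<le> n * (W - l)"
      by (intro independent_set_ratio_bound[OF A sym ones l_le]) (auto simp: U_def W_ge)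
    then have "real (card U) \<le> real n * ((W - l) / (poly p d - l))"
      using gt by (simp add: field_simps)
    then show ?thesis unfolding F_def card_U by (simp add: le_floor_iff)
  qed
  \<comment> \<open>The colour classes partition \<open>E\<close>, so the number of colours times
    the class bound is at least the number of edges.\<close>
  have "card E = (\<Sum>a\<in>c ` E. card {e \<in> E. c e = a})"
    using sum.image_gen[OF \<open>finite E\<close>, of "\<lambda>_. 1 :: nat" c] by simp
  then have "int n = (\<Sum>a\<in>c ` E. int (card {e \<in> E. c e = a}))" using n by simp
  also have "\<dots> \<le> int (card (c ` E)) * F" using class_le by (rule sum_bounded_above)
  finally have "real n \<le> real (distance_chromatic_index t E) * real_of_int F"
    unfolding c(2) by (metis of_int_le_iff of_int_mult of_int_of_nat_eq)
  \<comment> \<open>Positivity of the denominator: some colour class is nonempty and has at most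
    \<open>F\<close> elements.\<close>
  moreover have "F > 0"
  proof -
    obtain e where e: "e \<in> E" using assms(4) by fastforce
    then have "card {e' \<in> E. c e' = c e} > 0" using \<open>finite E\<close> by (auto simp: card_gt_0_iff)
    then show ?thesis using class_le[of "c e"] e by simp
  qed
  ultimately have "real n / real_of_int F \<le> real (distance_chromatic_index t E)"
    by (simp add: pos_divide_le_eq)
  then show ?thesis unfolding F_def W_def l_def n eig1 .
qed

end
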